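(* Let $\boldsymbol{a}=(a_n)_{n\ge1}$ be the sequence of Schur parameters of a probability measure $\mu$ on $\mathbb{T}$ with infinite support. If $\lim_n\left|\frac{a_{n+1}}{a_n}\right|=1$, then $$\{\mathrm{supp}\,\mu\}'\subset\bigcup_{\lambda\in\mathfrak{L}\left\{\frac{a_{n+1}}{a_n}\right\}}\triangle_\alpha(\lambda),$$ where $\alpha\in[0,\pi]$ is given by $\sin\frac{\alpha}{2}=\liminf_n|a_n|$.
   Context: $\mathbb{T}=\{z\in\mathbb{C}:|z|=1\}$. The Schur parameters of $\mu$ are defined from the orthonormal polynomials $\varphi_n(z)=\kappa_n(z^n+\cdots+a_n)$, $\kappa_n>0$, in $L^2_\mu$: $a_n$ is the constant term of the monic orthogonal polynomial of degree $n$; one has $|a_n|<1$. $\{\mathrm{supp}\,\mu\}'$ is the derived set (set of accumulation points) of the support of $\mu$. $\mathfrak{L}\{c_n\}$ denotes the set of limit points (limits of subsequences) of a sequence $(c_n)$ in $\mathbb{C}$. The hypothesis includes that $a_n\ne0$ for all sufficiently large $n$, so that $a_{n+1}/a_n$ makes sense for such $n$. For $\lambda\in\mathbb{T}$ and $\alpha\in[0,\pi]$, $\triangle_\alpha(\lambda):=\{e^{i\theta}\lambda:\alpha\le\theta\le2\pi-\alpha\}$; thus $\triangle_0(\lambda)=\mathbb{T}$. *)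

theory Defs
  imports "HOL-Probability.Probability" "HOL-Computational_Algebra.Polynomial"
begin

definition prob_measure_on_circle :: "complex measure \<Rightarrow> bool" where
  "prob_measure_on_circle M \<longleftrightarrow>
     prob_space M \<and> sets M = sets (restrict_space borel (sphere 0 1))"

(* The relatively open sets are U \<inter> space M; the intersection is essential, since emeasure is 0
   on sets that are not in sets M. *)
definition measure_support :: "'a::topological_space measure \<Rightarrow> 'a set" where
  "measure_support M =
     {x \<in> space M. \<forall>U. open U \<longrightarrow> x \<in> U \<longrightarrow> emeasure M (U \<inter> space M) > 0}"

definition derived_set :: "'a::topological_space set \<Rightarrow> 'a set" where
  "derived_set S = {x. x islimpt S}"

definition poly_inner :: "complex measure \<Rightarrow> complex poly \<Rightarrow> complex poly \<Rightarrow> complex" where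
  "poly_inner M p q = (LINT z|M. poly p z * cnj (poly q z))"

definition orthonormal_polys :: "complex measure \<Rightarrow> (nat \<Rightarrow> complex poly) \<Rightarrow> bool" where
  "orthonormal_polys M \<phi> \<longleftrightarrow>
     (\<forall>n. degree (\<phi> n) = n) \<and>
     (\<forall>n. \<exists>\<kappa>::real. \<kappa> > 0 \<and> lead_coeff (\<phi> n) = of_real \<kappa>) \<and>
     (\<forall>m n. poly_inner M (\<phi> m) (\<phi> n) = (if m = n then 1 else 0))"

(* Sign convention: a n is the constant term of the monic orthogonal polynomial itself, not its
   negative conjugate (the Verblunsky coefficient). The sequence is indexed by n >= 1, so a 0 is
   left unconstrained. *)
definition schur_parameters :: "complex measure \<Rightarrow> (nat \<Rightarrow> complex) \<Rightarrow> bool" where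
  "schur_parameters M a \<longleftrightarrow>
     (\<exists>\<phi>. orthonormal_polys M \<phi> \<and>
        (\<forall>n\<ge>1. a n = coeff (smult (inverse (lead_coeff (\<phi> n))) (\<phi> n)) 0))"

(* Limits of subsequences, as opposed to accumulation points of the range. *)
definition seq_limit_points :: "(nat \<Rightarrow> 'a::topological_space) \<Rightarrow> 'a set" where
  "seq_limit_points c = {l. \<exists>r::nat \<Rightarrow> nat. strict_mono r \<and> (c \<circ> r) \<longlonglongrightarrow> l}"

definition circle_arc :: "real \<Rightarrow> complex \<Rightarrow> complex set" where
  "circle_arc \<alpha> l = {exp (\<i> * of_real \<theta>) * l | \<theta>::real. \<alpha> \<le> \<theta> \<and> \<theta> \<le> 2 * pi - \<alpha>}"

end

theory Submission
  imports Defs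
begin

text \<open>
  Write \<open>b\<^sub>n = a\<^bsub>n+1\<^esub> / a\<^sub>n\<close> and \<open>\<rho>\<^sub>n = \<kappa>\<^bsub>n-1\<^esub> / \<kappa>\<^sub>n\<close>, so that \<open>\<rho>\<^sub>n\<^sup>2 \<le> 1 - |a\<^sub>n|\<^sup>2\<close>
  (\<open>rho_schur\<close>). Where \<open>a\<^sub>n \<noteq> 0\<close>, the orthonormal polynomials satisfy the three-term recurrence
  (\<open>three_term_recurrence\<close>)
  \<open>\<rho>\<^bsub>n+1\<^esub> \<phi>\<^bsub>n+1\<^esub> = (z + b\<^sub>n) \<phi>\<^sub>n - b\<^sub>n \<rho>\<^sub>n z \<phi>\<^bsub>n-1\<^esub>\<close>.

  For unimodular \<open>z\<close> and \<open>l\<close>, the point \<open>z\<close> lies outside the arc \<open>\<triangle>\<^sub>\<alpha>(l)\<close> exactly when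
  \<open>|z + l| > 2 cos (\<alpha>/2)\<close>. The choice of \<open>\<alpha>\<close> gives \<open>limsup \<rho>\<^sub>n \<le> cos (\<alpha>/2)\<close>. So if \<open>z\<close> avoids
  the arcs of all limit points of \<open>b\<close>, then, by compactness of the set of limit points and since
  \<open>|b\<^sub>n|\<close> tends to 1, the middle coefficient of the recurrence eventually exceeds the sum of the two
  outer ones, by a fixed margin and uniformly in a neighbourhood \<open>V\<close> of \<open>z\<close>.

  Under such dominance the sequence \<open>|\<phi>\<^sub>n(w)|\<close> has only two possible behaviours at a point \<open>w\<close> of
  \<open>V\<close>: once it increases it grows geometrically for ever, and otherwise it decays geometrically
  from an index that does not depend on \<open>w\<close>. Growth is excluded on the support: it would persist at nearby points, hence on a
  set of positive measure, against \<open>\<integral>|\<phi>\<^sub>n|\<^sup>2 = 1\<close> (\<open>growth_off_support\<close>). Decay bounds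
  \<open>\<Sum>|\<phi>\<^sub>n(w)|\<^sup>2\<close> by a constant \<open>D\<close> uniform on the part of the support in \<open>V\<close>. The reciprocal of this
  sum is the least squared norm of a polynomial with value 1 at \<open>w\<close>, and explicit test polynomials
  show that this minimum is at most the mass of \<open>w\<close> (\<open>point_mass_lower_bound\<close>). Every point of the
  support in \<open>V\<close> thus carries mass at least \<open>1 / D\<close>; there are finitely many of them, and \<open>z\<close> is
  not an accumulation point (\<open>finite_support_dominated\<close>).
\<close>

section \<open>Sequences dominated by their neighbours\<close>

text \<open>At the first increase, \<open>d u\<^bsub>n+1\<^esub> \<le> r (u\<^bsub>n+2\<^esub> + u\<^sub>n) \<le> r (u\<^bsub>n+2\<^esub> + u\<^bsub>n+1\<^esub>)\<close> forces an increase by the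
  factor \<open>d / r - 1 > 1\<close> at the next step, and so on.\<close>

lemma dominated_recurrence_growth:
  fixes u :: "nat \<Rightarrow> real"
  assumes rec: "\<And>n. N \<le> n \<Longrightarrow> d * u (Suc n) \<le> r * (u (Suc (Suc n)) + u n)"
    and "0 < r" "2 * r < d" and "N \<le> n" "u n < u (Suc n)" and nonneg: "\<And>n. 0 \<le> u n"
  shows "(d / r - 1) ^ k * u (Suc n) \<le> u (Suc n + k)"
proof -
  define q where "q = d / r - 1"
  have q: "1 < q" using assms by (simp add: q_def field_simps)
  have step: "q * u (Suc m) \<le> u (Suc (Suc m))" if "N \<le> m" "u m \<le> u (Suc m)" for m
  proof -
    have "d * u (Suc m) \<le> r * (u (Suc (Suc m)) + u (Suc m))"
      using rec[OF that(1)] that(2) \<open>0 < r\<close> by (smt (verit) mult_left_mono)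
    then show ?thesis using \<open>0 < r\<close> by (simp add: q_def field_simps)
  qed
  have "q ^ k * u (Suc n) \<le> u (Suc n + k) \<and> u (n + k) \<le> u (Suc n + k)"
  proof (induction k)
    case 0
    then show ?case using assms by simp
  next
    case (Suc k)
    have *: "q * u (Suc (n + k)) \<le> u (Suc (Suc (n + k)))"
      using step[of "n + k"] Suc assms by simp
    have "q ^ Suc k * u (Suc n) \<le> q * u (Suc (n + k))"
      using Suc q by (simp add: mult.assoc)
    moreover have "u (Suc (n + k)) \<le> q * u (Suc (n + k))"
      using q nonneg[of "Suc (n + k)"] mult_right_mono[of 1 q] by fastforce
    ultimately show ?case using * by simp
  qed
  then show ?thesis by (simp add: q_def)
qed

text \<open>The mirror image: with no increase, \<open>u\<^bsub>n+2\<^esub> \<le> u\<^bsub>n+1\<^esub>\<close> turns the same inequality into a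
  decrease by that factor.\<close>

lemma dominated_recurrence_decay:
  fixes u :: "nat \<Rightarrow> real"
  assumes rec: "\<And>n. N \<le> n \<Longrightarrow> d * u (Suc n) \<le> r * (u (Suc (Suc n)) + u n)"
    and "0 < r" "2 * r < d" and dec: "\<And>n. N \<le> n \<Longrightarrow> u (Suc n) \<le> u n"
  shows "u (N + k) \<le> (1 / (d / r - 1)) ^ k * u N"
proof (induction k)
  case 0
  then show ?case by simp
next
  case (Suc k)
  define q where "q = d / r - 1"
  have q: "1 < q" using assms by (simp add: q_def field_simps)
  have "d * u (Suc (N + k)) \<le> r * (u (Suc (N + k)) + u (N + k))"
    using rec[of "N + k"] dec[of "Suc (N + k)"] \<open>0 < r\<close> by (smt (verit) le_add1 le_SucI mult_left_mono)
  then have "q * u (Suc (N + k)) \<le> u (N + k)" using \<open>0 < r\<close> by (simp add: q_def field_simps)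
  then have "u (Suc (N + k)) \<le> (1 / q) * u (N + k)" using q by (simp add: field_simps)
  also have "\<dots> \<le> (1 / q) * ((1 / q) ^ k * u N)"
    using Suc q by (intro mult_left_mono) (auto simp: q_def)
  finally show ?case by (simp add: q_def mult.assoc)
qed

section \<open>Orthonormal polynomials on the unit circle\<close>

locale circle_orthonormal =
  fixes M :: "complex measure" and \<phi> :: "nat \<Rightarrow> complex poly"
  assumes circle: "prob_measure_on_circle M"
    and orthonormal: "orthonormal_polys M \<phi>"
begin

sublocale prob_space M
  using circle by (simp add: prob_measure_on_circle_def)

lemma space_circle: "space M = sphere 0 1"
proof -
  have "sets M = sets (restrict_space borel (sphere 0 1))"
    using circle by (simp add: prob_measure_on_circle_def)
  then have "space M = space (restrict_space borel (sphere (0::complex) 1))"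
    by (rule sets_eq_imp_space_eq)
  then show ?thesis by (simp add: space_restrict_space)
qed

lemma measurable_circle:
  fixes f :: "complex \<Rightarrow> 'b::topological_space"
  assumes "f \<in> borel_measurable borel"
  shows "f \<in> borel_measurable M"
proof -
  have "f \<in> borel_measurable (restrict_space borel (sphere 0 1))"
    using assms by (rule measurable_restrict_space1)
  moreover have "measurable M borel = measurable (restrict_space borel (sphere 0 1)) borel"
    using circle by (intro measurable_cong_sets) (auto simp: prob_measure_on_circle_def)
  ultimately show ?thesis by blast
qed

lemma sets_circle: "A \<in> sets borel \<Longrightarrow> A \<inter> space M \<in> sets M"
  using circle space_circle
  by (auto simp: prob_measure_on_circle_def sets_restrict_space Int_commute)

lemma integrable_continuous:
  fixes f :: "complex \<Rightarrow> 'b::{banach, second_countable_topology}"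
  assumes "continuous_on UNIV f"
  shows "integrable M f"
proof -
  have "compact (f ` sphere 0 1)"
    using assms by (intro compact_continuous_image) (auto intro: continuous_on_subset)
  then obtain B where "\<And>z. z \<in> sphere 0 1 \<Longrightarrow> norm (f z) \<le> B"
    by (meson bounded_iff compact_imp_bounded imageI)
  moreover have "f \<in> borel_measurable M"
    using assms by (intro measurable_circle borel_measurable_continuous_onI)
  ultimately show ?thesis
    by (intro integrable_const_bound[where B = B]) (auto simp: space_circle)
qed

abbreviation ip :: "complex poly \<Rightarrow> complex poly \<Rightarrow> complex" where
  "ip \<equiv> poly_inner M"

lemma integrable_poly: "integrable M (\<lambda>z. poly p z * cnj (poly q z))"
  by (intro integrable_continuous continuous_intros)

lemma ip_add_left: "ip (p + q) s = ip p s + ip q s"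
  by (simp add: poly_inner_def distrib_right integrable_poly)

lemma ip_diff_left: "ip (p - q) s = ip p s - ip q s"
  by (simp add: poly_inner_def left_diff_distrib integrable_poly)

lemma ip_smult_left: "ip (smult c p) s = c * ip p s"
  by (simp add: poly_inner_def mult.assoc integrable_poly)

lemma ip_sum_left: "ip (\<Sum>i\<in>A. f i) s = (\<Sum>i\<in>A. ip (f i) s)"
proof (induction A rule: infinite_finite_induct)
  case (insert x F)
  then show ?case by (simp add: ip_add_left)
qed (auto simp: poly_inner_def)

lemma ip_cnj: "cnj (ip p q) = ip q p"
proof -
  have "cnj (ip p q) = (LINT z|M. cnj (poly p z * cnj (poly q z)))"
    unfolding poly_inner_def by (rule Bochner_Integration.integral_cnj[symmetric])
  then show ?thesis by (simp add: poly_inner_def mult.commute)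
qed

lemma ip_sum_right: "ip s (\<Sum>i\<in>A. f i) = (\<Sum>i\<in>A. ip s (f i))"
  by (subst (1 2) ip_cnj[symmetric]) (simp add: ip_sum_left)

lemma ip_smult_right: "ip s (smult c p) = cnj c * ip s p"
  by (subst (1 2) ip_cnj[symmetric]) (simp add: ip_smult_left)

lemma ip_diff_right: "ip s (p - q) = ip s p - ip s q"
  by (subst (1 2 3) ip_cnj[symmetric]) (simp add: ip_diff_left)

text \<open>Multiplication by the variable is unitary on the circle.\<close>

lemma ip_shift: "ip (pCons 0 p) (pCons 0 q) = ip p q"
  unfolding poly_inner_def
proof (rule Bochner_Integration.integral_cong[OF refl])
  fix z assume "z \<in> space M"
  then have "z * cnj z = 1" by (simp add: space_circle complex_norm_square[symmetric])
  then show "poly (pCons 0 p) z * cnj (poly (pCons 0 q) z) = poly p z * cnj (poly q z)"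
    by (simp add: algebra_simps)
qed

lemma ip_self: "ip p p = of_real (LINT z|M. (norm (poly p z))\<^sup>2)"
  by (simp add: poly_inner_def complex_norm_square[symmetric] flip: of_real_power)

definition \<kappa> :: "nat \<Rightarrow> real" where "\<kappa> n = Re (lead_coeff (\<phi> n))"

lemma degree_phi [simp]: "degree (\<phi> n) = n"
  using orthonormal by (auto simp: orthonormal_polys_def)

lemma kappa_pos: "0 < \<kappa> n" and lead_coeff_phi: "coeff (\<phi> n) n = of_real (\<kappa> n)"
proof -
  have "\<exists>k::real. k > 0 \<and> coeff (\<phi> n) n = of_real k"
    using orthonormal degree_phi[of n] unfolding orthonormal_polys_def by metis
  then show "0 < \<kappa> n" "coeff (\<phi> n) n = of_real (\<kappa> n)" by (auto simp: \<kappa>_def)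
qed

lemma ip_phi: "ip (\<phi> m) (\<phi> n) = (if m = n then 1 else 0)"
  using orthonormal by (auto simp: orthonormal_polys_def)

text \<open>Degree bounds are stated as vanishing of coefficients: the condition \<open>degree p < m\<close> would
  exclude the zero polynomial when \<open>m = 0\<close>, which is where the induction starts.\<close>

lemma orthonormal_expansion_exists:
  assumes "\<And>i. m \<le> i \<Longrightarrow> coeff p i = 0"
  shows "\<exists>c. p = (\<Sum>k<m. smult (c k) (\<phi> k))"
  using assms
proof (induction m arbitrary: p)
  case 0
  then show ?case by (simp add: poly_eq_iff)
next
  case (Suc m)
  define t where "t = coeff p m / of_real (\<kappa> m)"
  have "coeff (p - smult t (\<phi> m)) i = 0" if "m \<le> i" for i
  proof (cases "i = m")
    case True
    then show ?thesis using kappa_pos[of m] by (simp add: t_def lead_coeff_phi)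
  next
    case False
    then show ?thesis using Suc.prems[of i] that by (simp add: coeff_eq_0)
  qed
  from Suc.IH[OF this] obtain c where c: "p - smult t (\<phi> m) = (\<Sum>k<m. smult (c k) (\<phi> k))"
    by blast
  have "p = (\<Sum>k<Suc m. smult ((c(m := t)) k) (\<phi> k))"
    using c by (simp add: algebra_simps)
  then show ?case by blast
qed

lemma orthonormal_expansion:
  assumes "\<And>i. m \<le> i \<Longrightarrow> coeff p i = 0"
  shows "p = (\<Sum>k<m. smult (ip p (\<phi> k)) (\<phi> k))"
proof -
  obtain c where c: "p = (\<Sum>k<m. smult (c k) (\<phi> k))"
    using orthonormal_expansion_exists[OF assms] by blast
  have "ip p (\<phi> j) = c j" if "j < m" for j
    using that by (subst c) (simp add: ip_sum_left ip_smult_left ip_phi if_distrib sum.If_cases)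
  then show ?thesis by (subst c) simp
qed

lemma parseval:
  assumes "\<And>i. m \<le> i \<Longrightarrow> coeff p i = 0"
  shows "(LINT z|M. (norm (poly p z))\<^sup>2) = (\<Sum>k<m. (norm (ip p (\<phi> k)))\<^sup>2)"
proof -
  have "ip p p = (\<Sum>k<m. cnj (ip p (\<phi> k)) * ip p (\<phi> k))"
    by (subst (2) orthonormal_expansion[OF assms]) (simp_all add: ip_sum_right ip_smult_right)
  also have "\<dots> = of_real (\<Sum>k<m. (norm (ip p (\<phi> k)))\<^sup>2)"
    by (simp add: complex_norm_square mult.commute del: of_real_power)
  finally show ?thesis unfolding ip_self of_real_eq_iff .
qed

text \<open>In the expansion of a polynomial of degree at most \<open>n\<close>, only \<open>\<phi> n\<close> contributes to the
  coefficient of \<open>z\<^sup>n\<close>. In particular \<open>\<phi> n\<close> is orthogonal to all lower degrees.\<close>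

lemma ip_top:
  assumes "\<And>i. n < i \<Longrightarrow> coeff p i = 0"
  shows "ip p (\<phi> n) = coeff p n / of_real (\<kappa> n)"
proof -
  have e: "p = (\<Sum>k<Suc n. smult (ip p (\<phi> k)) (\<phi> k))"
    by (rule orthonormal_expansion) (use assms in auto)
  have "coeff p n = (\<Sum>k<Suc n. ip p (\<phi> k) * coeff (\<phi> k) n)"
    by (subst e) (simp add: coeff_sum)
  also have "\<dots> = ip p (\<phi> n) * of_real (\<kappa> n)"
    by (simp add: coeff_eq_0 lead_coeff_phi)
  finally show ?thesis using kappa_pos[of n] by simp
qed

text \<open>A polynomial of degree at most \<open>m\<close> and the polynomial with reversed conjugate coefficients
  have the same modulus on the circle, and reversal turns the constant term into the top coefficient,
  which Bessel's inequality controls.\<close>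

lemma constant_term_bound:
  assumes "\<And>i. m < i \<Longrightarrow> coeff p i = 0"
  shows "(norm (coeff p 0) / \<kappa> m)\<^sup>2 \<le> (LINT z|M. (norm (poly p z))\<^sup>2)"
proof -
  define q where "q = (\<Sum>i\<le>m. monom (cnj (coeff p i)) (m - i))"
  have q0: "coeff q i = 0" if "m < i" for i
    using that by (simp add: q_def coeff_sum) (intro sum.neutral, auto)
  have "coeff q m = (\<Sum>i\<le>m. if i = 0 then cnj (coeff p 0) else 0)"
    unfolding q_def coeff_sum by (intro sum.cong) auto
  then have qm: "coeff q m = cnj (coeff p 0)" by simp
  have p_sum: "poly p z = (\<Sum>i\<le>m. coeff p i * z ^ i)" for z
  proof -
    have "degree p \<le> m" using assms by (auto intro: degree_le)
    then show ?thesis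
      unfolding poly_altdef by (intro sum.mono_neutral_left) (auto simp: coeff_eq_0)
  qed
  have mod: "norm (poly q z) = norm (poly p z)" if "z \<in> space M" for z
  proof -
    have z: "z * cnj z = 1" "norm z = 1"
      using that by (simp_all add: space_circle complex_norm_square[symmetric])
    have "z ^ m * cnj (z ^ i) = z ^ (m - i)" if "i \<le> m" for i
    proof -
      have "z ^ m * cnj (z ^ i) = z ^ (m - i) * (z * cnj z) ^ i"
        using that by (simp add: power_mult_distrib flip: power_add)
      then show ?thesis using z by simp
    qed
    then have "z ^ m * cnj (poly p z) = poly q z"
      unfolding p_sum q_def poly_sum poly_monom cnj_sum sum_distrib_left
      by (intro sum.cong) (simp_all add: mult.left_commute)
    then have "norm (poly q z) = norm (z ^ m * cnj (poly p z))" by simp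
    then show ?thesis using z by (simp add: norm_mult norm_power)
  qed
  have "norm (ip q (\<phi> m)) = norm (coeff p 0) / \<kappa> m"
    using ip_top[OF q0] qm kappa_pos[of m] by (simp add: norm_divide)
  then have "(norm (coeff p 0) / \<kappa> m)\<^sup>2 = (norm (ip q (\<phi> m)))\<^sup>2" by simp
  also have "\<dots> \<le> (\<Sum>k<Suc m. (norm (ip q (\<phi> k)))\<^sup>2)"
    by (rule member_le_sum) auto
  also have "\<dots> = (LINT z|M. (norm (poly q z))\<^sup>2)"
    by (rule parseval[symmetric]) (use q0 in auto)
  also have "\<dots> = (LINT z|M. (norm (poly p z))\<^sup>2)"
    by (rule Bochner_Integration.integral_cong) (simp_all add: mod)
  finally show ?thesis .
qed

section \<open>Schur parameters and the three-term recurrence\<close>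

definition schur :: "nat \<Rightarrow> complex" where
  "schur n = coeff (\<phi> n) 0 / of_real (\<kappa> n)"

definition \<rho> :: "nat \<Rightarrow> real" where
  "\<rho> n = \<kappa> (n - 1) / \<kappa> n"

lemma rho_pos: "0 < \<rho> n"
  using kappa_pos by (simp add: \<rho>_def)

lemma coeff_phi_0: "coeff (\<phi> n) 0 = of_real (\<kappa> n) * schur n"
  using kappa_pos[of n] by (simp add: schur_def)

lemma rho_kappa: "\<rho> (Suc n) * \<kappa> (Suc n) = \<kappa> n"
  using kappa_pos[of "Suc n"] by (simp add: \<rho>_def)

text \<open>The polynomial \<open>R = \<rho>\<^sub>n \<phi>\<^sub>n - z \<phi>\<^bsub>n-1\<^esub>\<close> has degree below \<open>n\<close>, hence is orthogonal to \<open>\<phi>\<^sub>n\<close>, and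
  Pythagoras gives \<open>1 = \<rho>\<^sub>n\<^sup>2 + \<parallel>R\<parallel>\<^sup>2\<close>. Its constant term is \<open>\<kappa>\<^bsub>n-1\<^esub>\<close> times the Schur parameter, so
  \<open>\<parallel>R\<parallel>\<close> is at least the modulus of that parameter.\<close>

lemma rho_schur: "(\<rho> (Suc m))\<^sup>2 + (norm (schur (Suc m)))\<^sup>2 \<le> 1"
proof -
  define n where "n = Suc m"
  define R where "R = smult (of_real (\<rho> n)) (\<phi> n) - pCons 0 (\<phi> m)"
  have R0: "coeff R i = 0" if "m < i" for i
  proof (cases "i = n")
    case True
    then show ?thesis
      using rho_kappa[of m] by (simp add: R_def n_def lead_coeff_phi flip: of_real_mult)
  next
    case False
    then have "n < i" "m < i - 1" using that by (auto simp: n_def)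
    then show ?thesis by (simp add: R_def coeff_eq_0 coeff_pCons split: nat.split)
  qed
  have Rn: "ip R (\<phi> n) = 0"
    using ip_top[of n R] R0 by (simp add: n_def)
  then have Rn': "ip (\<phi> n) R = 0" using ip_cnj[of R "\<phi> n"] by simp
  have "pCons 0 (\<phi> m) = smult (of_real (\<rho> n)) (\<phi> n) - R" by (simp add: R_def)
  then have "ip (pCons 0 (\<phi> m)) (pCons 0 (\<phi> m)) = of_real ((\<rho> n)\<^sup>2) + ip R R"
    by (simp add: ip_diff_left ip_diff_right ip_smult_left ip_smult_right Rn Rn' ip_phi
        power2_eq_square)
  then have "1 = of_real ((\<rho> n)\<^sup>2) + complex_of_real (LINT z|M. (norm (poly R z))\<^sup>2)"
    by (simp add: ip_shift ip_phi ip_self[of R])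
  then have "1 = (\<rho> n)\<^sup>2 + (LINT z|M. (norm (poly R z))\<^sup>2)"
    by (metis of_real_1 of_real_add of_real_eq_iff)
  moreover have "(norm (coeff R 0) / \<kappa> m)\<^sup>2 \<le> (LINT z|M. (norm (poly R z))\<^sup>2)"
    using R0 by (rule constant_term_bound)
  moreover have "coeff R 0 = of_real (\<kappa> m) * schur n"
    using rho_kappa[of m] by (simp add: R_def n_def coeff_phi_0 flip: of_real_mult mult.assoc)
  ultimately show ?thesis using kappa_pos[of m] by (simp add: n_def norm_mult)
qed

text \<open>With zero constant term \<open>p\<close> is \<open>z S\<close>, and orthogonality of \<open>p\<close> to \<open>z \<phi>\<^sub>j\<close> is orthogonality of
  \<open>S\<close> to \<open>\<phi>\<^sub>j\<close>.\<close>

lemma polynomial_eq_0I: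
  assumes "\<And>i. n < i \<Longrightarrow> coeff p i = 0" and "coeff p 0 = 0"
    and orth: "\<And>j. j < n \<Longrightarrow> ip p (pCons 0 (\<phi> j)) = 0"
  shows "p = 0"
proof -
  obtain c S where "p = pCons c S" by (cases p)
  then have p: "p = pCons 0 S" using assms(2) by simp
  have "coeff S i = 0" if "n \<le> i" for i
    using assms(1)[of "Suc i"] that p by simp
  then have "S = (\<Sum>k<n. smult (ip S (\<phi> k)) (\<phi> k))" by (rule orthonormal_expansion)
  also have "\<dots> = 0" using orth by (simp add: p ip_shift)
  finally show ?thesis using p by simp
qed

text \<open>Both bracketed polynomials have degree at most \<open>n = m + 1\<close> and are orthogonal to \<open>z, \<dots>, z\<^sup>n\<close>. Such
  polynomials are determined by their constant terms, and the Schur parameters are the factors that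
  make the two constant terms agree.\<close>

lemma three_term_recurrence:
  "smult (schur (Suc m))
     (smult (of_real (\<rho> (Suc (Suc m)))) (\<phi> (Suc (Suc m))) - pCons 0 (\<phi> (Suc m)))
   = smult (schur (Suc (Suc m)))
     (\<phi> (Suc m) - smult (of_real (\<rho> (Suc m))) (pCons 0 (\<phi> m)))"
  (is "?L = ?R")
proof -
  let ?n = "Suc m"
  have ip_zphi: "ip (\<phi> k) (pCons 0 (\<phi> j)) = cnj (coeff (pCons 0 (\<phi> j)) k) / of_real (\<kappa> k)"
    if "j < k" for j k
  proof -
    have "coeff (pCons 0 (\<phi> j)) i = 0" if "k < i" for i
      using that \<open>j < k\<close> by (cases i) (simp_all add: coeff_eq_0)
    then have "ip (pCons 0 (\<phi> j)) (\<phi> k) = coeff (pCons 0 (\<phi> j)) k / of_real (\<kappa> k)"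
      by (rule ip_top)
    then show ?thesis by (subst ip_cnj[symmetric]) simp
  qed
  have "?L - ?R = 0"
  proof (rule polynomial_eq_0I)
    fix i assume i: "?n < i"
    show "coeff (?L - ?R) i = 0"
    proof (cases "i = Suc ?n")
      case True
      then show ?thesis using rho_kappa[of ?n]
        by (simp add: lead_coeff_phi coeff_eq_0 flip: of_real_mult)
    next
      case False
      with i obtain k where "i = Suc k" "?n < k" by (cases i) auto
      then show ?thesis by (simp add: coeff_eq_0)
    qed
  next
    have "of_real (\<rho> (Suc ?n)) * coeff (\<phi> (Suc ?n)) 0 = of_real (\<kappa> ?n) * schur (Suc ?n)"
      using rho_kappa[of ?n] by (simp add: coeff_phi_0 flip: of_real_mult mult.assoc)
    then show "coeff (?L - ?R) 0 = 0" by (simp add: coeff_phi_0)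
  next
    fix j assume j: "j < ?n"
    have 1: "ip (\<phi> (Suc ?n)) (pCons 0 (\<phi> j)) = 0"
      using j by (simp add: ip_zphi coeff_eq_0)
    have 2: "ip (\<phi> ?n) (pCons 0 (\<phi> j)) = (if j = m then of_real (\<rho> ?n) else 0)"
      using j by (auto simp: ip_zphi coeff_eq_0 lead_coeff_phi \<rho>_def)
    show "ip (?L - ?R) (pCons 0 (\<phi> j)) = 0"
      using j by (simp add: ip_diff_left ip_smult_left 1 2 ip_shift ip_phi)
  qed
  then show ?thesis by simp
qed

lemma three_term_bound:
  assumes nz: "schur (Suc m) \<noteq> 0" and z: "norm z = 1"
  defines "b \<equiv> schur (Suc (Suc m)) / schur (Suc m)"
  shows "norm (z + b) * norm (poly (\<phi> (Suc m)) z)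
    \<le> \<rho> (Suc (Suc m)) * norm (poly (\<phi> (Suc (Suc m))) z)
      + norm b * \<rho> (Suc m) * norm (poly (\<phi> m) z)"
proof -
  let ?p = "\<lambda>n. poly (\<phi> n) z"
  have b: "schur (Suc (Suc m)) = b * schur (Suc m)" using nz by (simp add: b_def)
  have "schur (Suc m) * (of_real (\<rho> (Suc (Suc m))) * ?p (Suc (Suc m)) - z * ?p (Suc m))
      = schur (Suc m) * (b * (?p (Suc m) - of_real (\<rho> (Suc m)) * (z * ?p m)))"
    using arg_cong[OF three_term_recurrence[of m], of "\<lambda>q. poly q z"] by (simp add: b mult.left_commute)
  then have "of_real (\<rho> (Suc (Suc m))) * ?p (Suc (Suc m)) - z * ?p (Suc m)
      = b * (?p (Suc m) - of_real (\<rho> (Suc m)) * (z * ?p m))"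
    using nz by (metis mult_left_cancel)
  then have "(z + b) * ?p (Suc m)
      = of_real (\<rho> (Suc (Suc m))) * ?p (Suc (Suc m)) + b * of_real (\<rho> (Suc m)) * z * ?p m"
    by (simp add: algebra_simps)
  then have "norm ((z + b) * ?p (Suc m)) \<le> norm (of_real (\<rho> (Suc (Suc m))) * ?p (Suc (Suc m)))
      + norm (b * of_real (\<rho> (Suc m)) * z * ?p m)"
    by (metis norm_triangle_ineq)
  then show ?thesis
    using z rho_pos[of "Suc m"] rho_pos[of "Suc (Suc m)"] by (simp add: norm_mult)
qed

section \<open>Point masses and the Christoffel--Darboux kernel\<close>

text \<open>The sum on the right is the Christoffel--Darboux kernel on the diagonal; the bound is
  Cauchy--Schwarz applied to the orthonormal expansion of \<open>p\<close> evaluated at \<open>x\<close>.\<close>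

lemma christoffel_bound:
  assumes "\<And>i. m \<le> i \<Longrightarrow> coeff p i = 0"
  shows "(norm (poly p x))\<^sup>2
    \<le> (LINT z|M. (norm (poly p z))\<^sup>2) * (\<Sum>k<m. (norm (poly (\<phi> k) x))\<^sup>2)"
proof -
  have "norm (poly p x) \<le> (\<Sum>k<m. norm (ip p (\<phi> k)) * norm (poly (\<phi> k) x))"
    by (subst orthonormal_expansion[OF assms], assumption)
      (auto simp: poly_sum norm_mult intro!: sum_norm_le)
  then have "(norm (poly p x))\<^sup>2 \<le> (\<Sum>k<m. norm (ip p (\<phi> k)) * norm (poly (\<phi> k) x))\<^sup>2"
    by (intro power_mono) auto
  also have "\<dots> \<le> (\<Sum>k<m. (norm (ip p (\<phi> k)))\<^sup>2) * (\<Sum>k<m. (norm (poly (\<phi> k) x))\<^sup>2)"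
    by (rule Cauchy_Schwarz_ineq_sum)
  finally show ?thesis by (simp only: parseval[OF assms])
qed

text \<open>The polynomials \<open>((1 + cnj x z) / 2)\<^sup>n\<close> take the value 1 at \<open>x\<close> and tend to 0 elsewhere on the
  circle, so their squared norms tend to the mass of \<open>x\<close>.\<close>

lemma point_mass_lower_bound:
  assumes x: "norm x = 1" and D: "\<And>m. (\<Sum>k<m. (norm (poly (\<phi> k) x))\<^sup>2) \<le> D"
  shows "1 \<le> measure M {x} * D"
proof -
  define l where "l = [:1 / 2, cnj x / 2:]"
  have l: "poly l z = (1 + cnj x * z) / 2" for z by (simp add: l_def field_simps)
  have xx: "cnj x * x = 1" using x by (simp add: complex_norm_square[symmetric] mult.commute)
  have lx: "poly l x = 1" using xx by (simp add: l)
  have le1: "norm (poly l z) \<le> 1" if "norm z = 1" for z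
    using norm_triangle_ineq[of 1 "cnj x * z"] that x by (simp add: l norm_mult norm_divide)
  have less1: "norm (poly l z) < 1" if z: "norm z = 1" "z \<noteq> x" for z
  proof (rule ccontr)
    assume "\<not> ?thesis"
    with le1[OF z(1)] have "norm (poly l z) = 1" by simp
    then have 2: "norm (1 + cnj x * z) = 2" by (simp add: l norm_divide)
    \<comment> \<open>Equality in the triangle inequality for 1 and a unimodular number.\<close>
    define w where "w = cnj x * z"
    have w: "norm w = 1" using x z by (simp add: w_def norm_mult)
    have "w = 1" using 2 w norm_triangle_eq[of 1 w] by (simp add: w_def)
    then have "x * (cnj x * z) = x" by (simp add: w_def)
    then show False using xx z by (metis mult.assoc mult.commute mult_1)
  qed
  have ge: "1 \<le> (LINT z|M. (norm (poly l z) ^ n)\<^sup>2) * D" for n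
  proof -
    have "degree l \<le> 1" by (simp add: l_def)
    then have "degree (l ^ n) \<le> n"
      using degree_power_le[of l n] by (metis le_trans mult_le_mono1 mult_1)
    then have "coeff (l ^ n) i = 0" if "Suc n \<le> i" for i
      using that by (simp add: coeff_eq_0)
    from christoffel_bound[where m = "Suc n" and x = x, OF this]
    have "1 \<le> (LINT z|M. (norm (poly l z) ^ n)\<^sup>2) * (\<Sum>k<Suc n. (norm (poly (\<phi> k) x))\<^sup>2)"
      by (simp add: lx norm_power)
    also have "\<dots> \<le> (LINT z|M. (norm (poly l z) ^ n)\<^sup>2) * D"
      by (intro mult_left_mono D) auto
    finally show ?thesis .
  qed
  have "(\<lambda>n. LINT z|M. (norm (poly l z) ^ n)\<^sup>2) \<longlonglongrightarrow> (LINT z|M. indicator {x} z)"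
  proof (rule integral_dominated_convergence[where w = "\<lambda>_. 1"])
    show "AE z in M. (\<lambda>n. (norm (poly l z) ^ n)\<^sup>2) \<longlonglongrightarrow> indicator {x} z"
    proof (rule AE_I2)
      fix z assume "z \<in> space M"
      then have z: "norm z = 1" by (simp add: space_circle)
      show "(\<lambda>n. (norm (poly l z) ^ n)\<^sup>2) \<longlonglongrightarrow> indicator {x} z"
      proof (cases "z = x")
        case True
        then show ?thesis by (simp add: lx)
      next
        case False
        then have "(\<lambda>n. norm (poly l z) ^ n) \<longlonglongrightarrow> 0"
          using less1[OF z] by (intro LIMSEQ_power_zero) simp
        from tendsto_power[OF this, of 2] show ?thesis using False by simp
      qed
    qed
    show "AE z in M. norm ((norm (poly l z) ^ n)\<^sup>2) \<le> 1" for n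
      using le1 by (intro AE_I2) (auto simp: space_circle power_le_one)
    show "(\<lambda>z. (norm (poly l z) ^ n)\<^sup>2) \<in> borel_measurable M" for n
      by (intro borel_measurable_integrable integrable_continuous continuous_intros)
    show "(indicator {x} :: complex \<Rightarrow> real) \<in> borel_measurable M"
      by (intro measurable_circle) simp
  qed simp
  moreover have "{x} \<inter> space M = {x}" using x by (auto simp: space_circle)
  ultimately have "(\<lambda>n. LINT z|M. (norm (poly l z) ^ n)\<^sup>2) \<longlonglongrightarrow> measure M {x}"
    by simp
  then have "(\<lambda>n. (LINT z|M. (norm (poly l z) ^ n)\<^sup>2) * D) \<longlonglongrightarrow> measure M {x} * D"
    by (intro tendsto_intros)
  then show ?thesis by (rule LIMSEQ_le_const) (use ge in auto)
qed

lemma finite_uniform_point_masses: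
  assumes "0 < \<epsilon>" and S: "\<And>x. x \<in> S \<Longrightarrow> x \<in> space M \<and> \<epsilon> \<le> measure M {x}"
  shows "finite S"
proof (rule ccontr)
  assume inf: "infinite S"
  obtain n :: nat where n: "1 / \<epsilon> < real n" using reals_Archimedean2 by blast
  obtain F where F: "finite F" "F \<subseteq> S" "card F = n"
    using infinite_arbitrarily_large[OF inf] by blast
  have single: "{x} \<in> sets M" if "x \<in> F" for x
  proof -
    have "{x} \<inter> space M = {x}" using S F that by auto
    then show ?thesis using sets_circle[of "{x}"] by simp
  qed
  have "real n * \<epsilon> = (\<Sum>x\<in>F. \<epsilon>)" using F by simp
  also have "\<dots> \<le> (\<Sum>x\<in>F. measure M {x})" using S F by (intro sum_mono) auto
  also have "\<dots> = measure M F"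
    using finite_measure_eq_sum_singleton[of F] F single by simp
  also have "\<dots> \<le> 1" by (rule prob_le_1)
  finally show False using n \<open>0 < \<epsilon>\<close> by (simp add: field_simps)
qed

text \<open>Around a point of the support the set \<open>V\<close> has positive measure, so the growth would make the
  \<open>L\<^sup>2\<close> norms of the \<open>\<phi>\<^sub>n\<close> unbounded.\<close>

lemma growth_off_support:
  assumes "open V" "x \<in> V" and q: "1 < q" and "0 < \<eta>"
    and growth: "\<And>k z. z \<in> V \<Longrightarrow> norm z = 1 \<Longrightarrow> \<eta> * q ^ k \<le> norm (poly (\<phi> (n + k)) z)"
  shows "x \<notin> measure_support M"
proof
  assume "x \<in> measure_support M"
  then have "emeasure M (V \<inter> space M) > 0"
    using \<open>open V\<close> \<open>x \<in> V\<close> by (auto simp: measure_support_def)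
  then have mpos: "0 < measure M (V \<inter> space M)"
    by (simp add: emeasure_eq_measure)
  have V: "V \<inter> space M \<in> sets M" using \<open>open V\<close> by (intro sets_circle) simp
  have bound: "(\<eta> * q ^ k)\<^sup>2 * measure M (V \<inter> space M) \<le> 1" for k
  proof -
    have "(\<eta> * q ^ k)\<^sup>2 * measure M (V \<inter> space M)
        = (LINT z|M. (\<eta> * q ^ k)\<^sup>2 * indicator (V \<inter> space M) z)"
      using V by simp
    also have "\<dots> \<le> (LINT z|M. (norm (poly (\<phi> (n + k)) z))\<^sup>2)"
    proof (rule integral_mono)
      show "integrable M (\<lambda>z. (\<eta> * q ^ k)\<^sup>2 * indicator (V \<inter> space M) z)"
        using V by (simp add: emeasure_eq_measure)
      show "integrable M (\<lambda>z. (norm (poly (\<phi> (n + k)) z))\<^sup>2)"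
        by (intro integrable_continuous continuous_intros)
      fix z assume "z \<in> space M"
      then show "(\<eta> * q ^ k)\<^sup>2 * indicator (V \<inter> space M) z \<le> (norm (poly (\<phi> (n + k)) z))\<^sup>2"
        using growth[of z k] q \<open>0 < \<eta>\<close>
        by (auto simp: space_circle indicator_def intro!: power_mono)
    qed
    also have "\<dots> = 1"
      using ip_self[of "\<phi> (n + k)"] by (simp add: ip_phi)
    finally show ?thesis .
  qed
  have mpos': "0 < \<eta>\<^sup>2 * measure M (V \<inter> space M)"
    using mpos \<open>0 < \<eta>\<close> by simp
  obtain k where "1 / (\<eta>\<^sup>2 * measure M (V \<inter> space M)) < (q\<^sup>2) ^ k"
    using real_arch_pow[of "q\<^sup>2"] one_less_power[OF q, of 2] by auto
  then have "1 < (q\<^sup>2) ^ k * (\<eta>\<^sup>2 * measure M (V \<inter> space M))"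
    using mpos' by (simp add: divide_less_eq)
  moreover have "(\<eta> * q ^ k)\<^sup>2 = (q\<^sup>2) ^ k * \<eta>\<^sup>2"
    by (simp add: power_mult_distrib mult.commute flip: power_mult)
  ultimately show False using bound[of k] by (simp add: mult.assoc)
qed

section \<open>Finiteness of the support where the recurrence is dominated\<close>

text \<open>The increase of \<open>|\<phi>\<^sub>n|\<close> at a single index is an open condition, which is what lets growth at a
  point be carried over to a neighbourhood.\<close>

lemma finite_support_dominated:
  assumes V: "open V" and r: "0 < r" "2 * r < d"
    and rec: "\<And>z n. z \<in> V \<Longrightarrow> norm z = 1 \<Longrightarrow> N \<le> n \<Longrightarrow>
      d * norm (poly (\<phi> (Suc n)) z)
        \<le> r * (norm (poly (\<phi> (Suc (Suc n))) z) + norm (poly (\<phi> n) z))"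
  shows "finite (V \<inter> measure_support M)"
proof -
  define q where "q = d / r - 1"
  have q: "1 < q" using r by (simp add: q_def field_simps)
  let ?u = "\<lambda>z n. norm (poly (\<phi> n) z)"
  have decr: "?u x (Suc n) \<le> ?u x n" if x: "x \<in> V \<inter> measure_support M" and "N \<le> n" for x n
  proof (rule ccontr)
    assume "\<not> ?thesis"
    then have less: "?u x n < ?u x (Suc n)" by simp
    \<comment> \<open>Half the value at \<open>x\<close>, so that it stays a lower bound near \<open>x\<close>.\<close>
    define \<eta> where "\<eta> = ?u x (Suc n) / 2"
    have \<eta>: "0 < \<eta>" "\<eta> < ?u x (Suc n)" using less norm_ge_zero[of "poly (\<phi> n) x"]
      by (auto simp: \<eta>_def simp del: norm_ge_zero)
    define W where "W = V \<inter> {z. ?u z n < ?u z (Suc n)} \<inter> {z. \<eta> < ?u z (Suc n)}"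
    have "open W" unfolding W_def
      by (intro open_Int V open_Collect_less continuous_intros)
    moreover have "x \<in> W" using x less \<eta> by (simp add: W_def)
    moreover have "\<eta> * q ^ k \<le> ?u z (Suc n + k)" if "z \<in> W" "norm z = 1" for z k
    proof -
      have "\<eta> * q ^ k \<le> q ^ k * ?u z (Suc n)"
        using that q by (simp add: W_def mult.commute)
      also have "\<dots> \<le> ?u z (Suc n + k)" unfolding q_def
        by (rule dominated_recurrence_growth[where N = N])
          (use rec that r \<open>N \<le> n\<close> in \<open>auto simp: W_def\<close>)
      finally show ?thesis .
    qed
    ultimately have "x \<notin> measure_support M"
      using growth_off_support[OF _ _ q \<eta>(1)] by blast
    then show False using x by simp
  qed
  have "\<exists>B. \<forall>z\<in>sphere 0 1. (\<Sum>k\<le>N. (?u z k)\<^sup>2) \<le> B"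
  proof -
    have "compact ((\<lambda>z. \<Sum>k\<le>N. (?u z k)\<^sup>2) ` sphere 0 1)"
      by (intro compact_continuous_image continuous_intros) auto
    from compact_imp_bounded[OF this] obtain B
      where "\<And>z. z \<in> sphere 0 1 \<Longrightarrow> norm (\<Sum>k\<le>N. (?u z k)\<^sup>2) \<le> B"
      unfolding bounded_iff by blast
    then show ?thesis by (intro exI[of _ B]) (force dest: abs_le_D1)
  qed
  then obtain B where "\<forall>z\<in>sphere 0 1. (\<Sum>k\<le>N. (?u z k)\<^sup>2) \<le> B" by blast
  then have B: "(\<Sum>k\<le>N. (?u z k)\<^sup>2) \<le> B" if "norm z = 1" for z using that by simp
  define t where "t = (1 / q)\<^sup>2"
  have t: "0 \<le> t" "t < 1" using q by (auto simp: t_def power_divide one_less_power)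
  \<comment> \<open>The first \<open>N\<close> terms and the geometric tail; the maximum only ensures positivity.\<close>
  define D where "D = max 1 (B + B / (1 - t))"
  have D: "(\<Sum>k<m. (?u x k)\<^sup>2) \<le> D" if x: "x \<in> V \<inter> measure_support M" for x m
  proof -
    have nx: "norm x = 1" using x by (simp add: measure_support_def space_circle)
    have decay: "(?u x (N + k))\<^sup>2 \<le> t ^ k * (?u x N)\<^sup>2" for k
    proof -
      have "?u x (N + k) \<le> (1 / q) ^ k * ?u x N" unfolding q_def
        by (rule dominated_recurrence_decay) (use rec r decr x nx in auto)
      then have "(?u x (N + k))\<^sup>2 \<le> ((1 / q) ^ k * ?u x N)\<^sup>2"
        by (intro power_mono) auto
      moreover have "((1 / q) ^ k)\<^sup>2 = t ^ k" by (simp only: t_def mult.commute flip: power_mult)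
      ultimately show ?thesis by (simp only: power_mult_distrib)
    qed
    have uN: "(?u x N)\<^sup>2 \<le> B"
      using B[OF nx] member_le_sum[of N "{..N}" "\<lambda>k. (?u x k)\<^sup>2"] by simp
    have B0: "0 \<le> B" using uN by (rule order_trans[rotated]) simp
    have "(\<Sum>k<m. (?u x k)\<^sup>2) \<le> (\<Sum>k<N + m. (?u x k)\<^sup>2)"
      by (intro sum_mono2) auto
    also have "\<dots> = (\<Sum>k<N. (?u x k)\<^sup>2) + (\<Sum>k<m. (?u x (N + k))\<^sup>2)"
      by (induction m) simp_all
    also have "(\<Sum>k<N. (?u x k)\<^sup>2) \<le> (\<Sum>k\<le>N. (?u x k)\<^sup>2)"
      by (intro sum_mono2) auto
    also have "\<dots> \<le> B" by (rule B[OF nx])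
    also have "(\<Sum>k<m. (?u x (N + k))\<^sup>2) \<le> (\<Sum>k<m. t ^ k * B)"
      using decay uN t by (intro sum_mono) (meson mult_left_mono order_trans zero_le_power)
    also have "\<dots> = (\<Sum>k<m. t ^ k) * B" by (simp add: sum_distrib_right)
    also have "\<dots> \<le> (1 / (1 - t)) * B"
    proof (rule mult_right_mono[OF _ B0])
      have "(\<Sum>k<m. t ^ k) \<le> (\<Sum>k. t ^ k)"
        using t by (intro sum_le_suminf summable_geometric) auto
      then show "(\<Sum>k<m. t ^ k) \<le> 1 / (1 - t)" using t by (simp add: suminf_geometric)
    qed
    finally show ?thesis by (simp add: D_def)
  qed
  show ?thesis
  proof (rule finite_uniform_point_masses)
    show "0 < 1 / D" by (simp add: D_def)
    fix x assume x: "x \<in> V \<inter> measure_support M"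
    then have xs: "x \<in> space M" by (simp add: measure_support_def)
    have "1 \<le> measure M {x} * D"
      using xs D[OF x] by (intro point_mass_lower_bound) (simp_all add: space_circle)
    moreover have "0 < D" by (simp add: D_def)
    ultimately show "x \<in> space M \<and> 1 / D \<le> measure M {x}" using xs by (simp add: field_simps)
  qed
qed

end

section \<open>The derived set of the support\<close>

text \<open>For \<open>z = e\<^bsup>i\<theta>\<^esup> l\<close> with \<open>0 \<le> \<theta> < 2\<pi>\<close> one has \<open>|z + l| = 2 |cos (\<theta>/2)|\<close>, and the cosine decreases on
  \<open>[0, \<pi>]\<close>.\<close>

lemma mem_circle_arcI:
  assumes "norm z = 1" "norm l = 1" "0 \<le> \<alpha>" "\<alpha> \<le> pi"
    and "norm (z + l) \<le> 2 * cos (\<alpha> / 2)"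
  shows "z \<in> circle_arc \<alpha> l"
proof -
  have l0: "l \<noteq> 0" using assms by auto
  define \<theta> where "\<theta> = Arg2pi (z / l)"
  have "norm (z / l) = 1" using assms by (simp add: norm_divide)
  then have \<theta>: "0 \<le> \<theta>" "\<theta> < 2 * pi" "z / l = exp (\<i> * of_real \<theta>)"
    using Arg2pi[of "z / l"] by (auto simp: \<theta>_def complex_norm_eq_1_exp)
  have z: "z = exp (\<i> * of_real \<theta>) * l" using \<theta> l0 by (simp add: field_simps)
  have c0: "0 \<le> cos (\<alpha> / 2)" using assms by (intro cos_ge_zero) auto
  have "z + l = (1 + cis \<theta>) * l" by (simp add: z cis_conv_exp algebra_simps)
  then have "(norm (z + l))\<^sup>2 = (norm (1 + cis \<theta>))\<^sup>2" using assms by (simp add: norm_mult)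
  also have "\<dots> = 2 + 2 * cos \<theta>"
    using sin_cos_squared_add[of \<theta>] unfolding cmod_power2
    by (simp add: power2_eq_square algebra_simps)
  also have "\<dots> = 4 * (cos (\<theta> / 2))\<^sup>2"
    using cos_double_cos[of "\<theta> / 2"] by simp
  finally have "4 * (cos (\<theta> / 2))\<^sup>2 \<le> (2 * cos (\<alpha> / 2))\<^sup>2"
    using power_mono[OF assms(5) norm_ge_zero, of 2] by simp
  then have "\<bar>cos (\<theta> / 2)\<bar> \<le> cos (\<alpha> / 2)"
    using c0 by (simp add: power_mult_distrib abs_le_square_iff[symmetric])
  then have c: "cos (\<theta> / 2) \<le> cos (\<alpha> / 2)" "cos (pi - \<theta> / 2) \<le> cos (\<alpha> / 2)"
    by (auto simp: abs_le_iff)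
  have "\<alpha> / 2 \<le> \<theta> / 2" "\<alpha> / 2 \<le> pi - \<theta> / 2"
    using c \<theta> assms cos_mono_le_eq[of "\<theta> / 2" "\<alpha> / 2"]
      cos_mono_le_eq[of "pi - \<theta> / 2" "\<alpha> / 2"] by linarith+
  then have "\<alpha> \<le> \<theta>" "\<theta> \<le> 2 * pi - \<alpha>" by auto
  then show ?thesis using z by (auto simp: circle_arc_def)
qed

text \<open>Otherwise infinitely many \<open>b\<^sub>n\<close> come arbitrarily close to violating the bound, and a convergent
  subsequence of them has a limit that does violate it.\<close>

lemma eventually_far_from_limit_points:
  fixes b :: "nat \<Rightarrow> complex"
  assumes "(\<lambda>n. norm (b n)) \<longlonglongrightarrow> 1"
    and far: "\<And>l. l \<in> seq_limit_points b \<Longrightarrow> norm l = 1 \<Longrightarrow> t < norm (z + l)"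
  shows "\<exists>\<epsilon>>0. \<forall>\<^sub>F n in sequentially. t + \<epsilon> \<le> norm (z + b n)"
proof (rule ccontr)
  assume "\<not> ?thesis"
  then have "\<exists>\<^sub>F n in sequentially. norm (z + b n) < t + 1 / real (Suc k)" for k
    by (auto simp: not_eventually not_le)
  then have ex: "\<exists>n>m. norm (z + b n) < t + 1 / real (Suc k)" for k m
    unfolding frequently_sequentially by (meson Suc_le_lessD)
  have "\<exists>r. \<forall>k. norm (z + b (r (Suc k))) < t + 1 / real (Suc k) \<and> r k < r (Suc k)"
    using dependent_nat_choice[of "\<lambda>_ _. True" "\<lambda>k m n. norm (z + b n) < t + 1 / real (Suc k) \<and> m < n"]
      ex by blast
  then obtain r where r: "\<And>k. norm (z + b (r (Suc k))) < t + 1 / real (Suc k)"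
    and "strict_mono r"
    by (auto simp: strict_mono_Suc_iff)
  define r' where "r' = r \<circ> Suc"
  have mono': "strict_mono r'" using \<open>strict_mono r\<close> by (auto simp: r'_def strict_mono_Suc_iff)
  have "Bseq (\<lambda>n. norm (b n))" using assms(1) by (intro convergent_imp_Bseq convergentI)
  then have "bounded (range b)"
    by (auto simp: Bseq_def bounded_iff)
  then have "bounded (range (b \<circ> r'))" by (rule bounded_subset) auto
  then obtain l s where s: "strict_mono s" "((b \<circ> r') \<circ> s) \<longlonglongrightarrow> l"
    using bounded_imp_convergent_subsequence by blast
  have mono: "strict_mono (r' \<circ> s)" using mono' s(1) by (rule strict_mono_o)
  have lim: "(b \<circ> (r' \<circ> s)) \<longlonglongrightarrow> l" using s(2) by (simp add: o_assoc)
  have "l \<in> seq_limit_points b" using mono lim by (auto simp: seq_limit_points_def)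
  moreover have "norm l = 1"
  proof (rule LIMSEQ_unique)
    show "(\<lambda>n. norm ((b \<circ> (r' \<circ> s)) n)) \<longlonglongrightarrow> norm l" by (intro tendsto_intros lim)
    show "(\<lambda>n. norm ((b \<circ> (r' \<circ> s)) n)) \<longlonglongrightarrow> 1"
      using LIMSEQ_subseq_LIMSEQ[OF assms(1) mono] by (simp add: o_def)
  qed
  ultimately have "t < norm (z + l)" by (rule far)
  moreover have "norm (z + l) \<le> t"
  proof (rule LIMSEQ_le)
    show "(\<lambda>n. norm (z + (b \<circ> (r' \<circ> s)) n)) \<longlonglongrightarrow> norm (z + l)" by (intro tendsto_intros lim)
    have "(\<lambda>k. t + 1 / real (Suc k)) \<longlonglongrightarrow> t + 0"
      by (intro tendsto_intros LIMSEQ_Suc[OF lim_1_over_n, unfolded o_def])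
    from LIMSEQ_subseq_LIMSEQ[OF this s(1)]
    show "(\<lambda>k. t + 1 / real (Suc (s k))) \<longlonglongrightarrow> t" by (simp add: o_def)
    show "\<exists>N. \<forall>n\<ge>N. norm (z + (b \<circ> (r' \<circ> s)) n) \<le> t + 1 / real (Suc (s n))"
      using r by (auto simp: r'_def less_imp_le)
  qed
  ultimately show False by simp
qed

theorem theorem3p10:
  fixes M :: "complex measure" and a :: "nat \<Rightarrow> complex" and \<alpha> :: real
  assumes "prob_measure_on_circle M"
    and "infinite (measure_support M)"
    and "schur_parameters M a"
    and "eventually (\<lambda>n. a n \<noteq> 0) sequentially"
    and "(\<lambda>n. norm (a (Suc n) / a n)) \<longlonglongrightarrow> 1"
    and "0 \<le> \<alpha>" and "\<alpha> \<le> pi"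
    and "ereal (sin (\<alpha> / 2)) = liminf (\<lambda>n. ereal (norm (a n)))"
  shows "derived_set (measure_support M)
           \<subseteq> (\<Union>l \<in> seq_limit_points (\<lambda>n. a (Suc n) / a n). circle_arc \<alpha> l)"
proof
  fix z assume "z \<in> derived_set (measure_support M)"
  then have lim: "z islimpt measure_support M" by (simp add: derived_set_def)
  obtain \<phi> where \<phi>: "orthonormal_polys M \<phi>"
    and a_phi: "\<And>n. n \<ge> 1 \<Longrightarrow> a n = coeff (smult (inverse (lead_coeff (\<phi> n))) (\<phi> n)) 0"
    using assms(3) unfolding schur_parameters_def by blast
  interpret circle_orthonormal M \<phi> by unfold_locales fact+
  have a: "a (Suc n) = schur (Suc n)" for n
    using a_phi[of "Suc n"] by (simp add: schur_def lead_coeff_phi field_simps)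
  have z: "norm z = 1"
  proof -
    have "z islimpt sphere 0 1"
      using lim by (rule islimpt_subset) (auto simp: measure_support_def space_circle)
    then show ?thesis using closed_limpt[of "sphere (0::complex) 1"] by auto
  qed
  define b where "b = (\<lambda>n. a (Suc n) / a n)"
  define s where "s = cos (\<alpha> / 2)"
  have s0: "0 \<le> s" using assms by (auto simp: s_def intro!: cos_ge_zero)
  have sn0: "0 \<le> sin (\<alpha> / 2)" using assms by (intro sin_ge_zero) auto
  show "z \<in> (\<Union>l \<in> seq_limit_points (\<lambda>n. a (Suc n) / a n). circle_arc \<alpha> l)"
  proof (rule ccontr)
    assume no: "\<not> ?thesis"
    have far: "2 * s < norm (z + l)" if "l \<in> seq_limit_points b" "norm l = 1" for l
    proof (rule ccontr)
      assume "\<not> ?thesis"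
      then have "z \<in> circle_arc \<alpha> l"
        using mem_circle_arcI[OF z that(2)] assms by (simp add: s_def)
      then show False using no that by (auto simp: b_def)
    qed
    have b1: "(\<lambda>n. norm (b n)) \<longlonglongrightarrow> 1" using assms by (simp add: b_def)
    obtain \<epsilon> where \<epsilon>: "0 < \<epsilon>" and ev_b: "\<forall>\<^sub>F n in sequentially. 2 * s + \<epsilon> \<le> norm (z + b n)"
      using eventually_far_from_limit_points[OF b1 far] by blast
    have rho_le: "(\<rho> n)\<^sup>2 \<le> 1 - (norm (a n))\<^sup>2" if "1 \<le> n" for n
      using that rho_schur[of "n - 1"] by (cases n) (auto simp: a)
    have rho_le1: "\<rho> n \<le> 1" if "1 \<le> n" for n
      using rho_le[OF that] power2_le_imp_le[of "\<rho> n" 1] by (smt (verit) one_power2 zero_le_power2)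
    have ev_rho: "\<forall>\<^sub>F n in sequentially. \<rho> n \<le> s + \<epsilon> / 16"
    proof (cases "1 \<le> s + \<epsilon> / 16")
      case True
      then show ?thesis
        using rho_le1 by (intro eventually_sequentiallyI[of 1]) force
    next
      case False
      define t where "t = s + \<epsilon> / 16"
      have t: "s < t" "t < 1" "0 \<le> t" using False \<epsilon> s0 by (auto simp: t_def)
      have t2: "s\<^sup>2 < t\<^sup>2" "t\<^sup>2 \<le> 1" using t s0 by (auto intro: power_strict_mono simp: power_le_one)
      have "sqrt (1 - t\<^sup>2) < sqrt (1 - s\<^sup>2)" using t2 by simp
      also have "1 - s\<^sup>2 = (sin (\<alpha> / 2))\<^sup>2" by (simp add: s_def sin_squared_eq)
      finally have "ereal (sqrt (1 - t\<^sup>2)) < liminf (\<lambda>n. ereal (norm (a n)))"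
        using sn0 by (simp flip: assms(8))
      then have "\<forall>\<^sub>F n in sequentially. ereal (sqrt (1 - t\<^sup>2)) < ereal (norm (a n))"
        by (rule less_LiminfD)
      then show ?thesis
        using eventually_ge_at_top[of 1]
      proof eventually_elim
        case (elim n)
        then have "sqrt (1 - t\<^sup>2) < norm (a n)" by simp
        then have "1 - t\<^sup>2 \<le> (norm (a n))\<^sup>2"
          using real_sqrt_less_iff sqrt_le_D by (metis less_imp_le)
        then have "(\<rho> n)\<^sup>2 \<le> t\<^sup>2" using rho_le[OF elim(2)] by linarith
        then show ?case using t(3) unfolding t_def[symmetric] by (rule power2_le_imp_le)
      qed
    qed
    have ev_b1: "\<forall>\<^sub>F n in sequentially. norm (b n) < 1 + \<epsilon> / 16"
      using order_tendstoD(2)[OF b1] \<epsilon> by simp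
    have "\<forall>\<^sub>F n in sequentially. a n \<noteq> 0 \<and> 2 * s + \<epsilon> \<le> norm (z + b n) \<and> \<rho> n \<le> s + \<epsilon> / 16
        \<and> norm (b n) < 1 + \<epsilon> / 16"
      using assms(4) ev_b ev_rho ev_b1 by eventually_elim simp
    then obtain N where N: "\<And>n. N \<le> n \<Longrightarrow> a n \<noteq> 0 \<and> 2 * s + \<epsilon> \<le> norm (z + b n)
        \<and> \<rho> n \<le> s + \<epsilon> / 16 \<and> norm (b n) < 1 + \<epsilon> / 16"
      by (auto simp: eventually_sequentially)
    \<comment> \<open>Of the margin \<open>\<epsilon>\<close>, one quarter is spent on moving from \<open>z\<close> to \<open>w\<close>, one quarter on the two
      outer coefficients; the rest makes \<open>2 r < d\<close> strict.\<close>
    define r where "r = s + \<epsilon> / 8"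
    define d where "d = 2 * s + 3 / 4 * \<epsilon>"
    have "finite (ball z (\<epsilon> / 4) \<inter> measure_support M)"
    proof (rule finite_support_dominated)
      show "0 < r" "2 * r < d" using s0 \<epsilon> by (auto simp: r_def d_def)
      fix w n assume w: "w \<in> ball z (\<epsilon> / 4)" "norm w = 1" and n: "N \<le> n"
      let ?u = "\<lambda>k. norm (poly (\<phi> k) w)"
      have N1: "a (Suc n) \<noteq> 0" "2 * s + \<epsilon> \<le> norm (z + b (Suc n))" "\<rho> (Suc n) \<le> s + \<epsilon> / 16"
        "norm (b (Suc n)) < 1 + \<epsilon> / 16" "\<rho> (Suc (Suc n)) \<le> s + \<epsilon> / 16"
        using N[of "Suc n"] N[of "Suc (Suc n)"] n by auto
      have "norm (z + b (Suc n)) \<le> norm (w + b (Suc n)) + dist z w"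
        using norm_triangle_ineq[of "w + b (Suc n)" "z - w"] by (simp add: dist_norm add.commute)
      then have dle: "d \<le> norm (w + b (Suc n))" using w N1 by (simp add: d_def)
      have "norm (b (Suc n)) * \<rho> (Suc n) \<le> (1 + \<epsilon> / 16) * \<rho> (Suc n)"
        using N1 rho_pos[of "Suc n"] by (intro mult_right_mono) auto
      also have "\<dots> \<le> \<rho> (Suc n) + \<epsilon> / 16"
        using rho_le1[of "Suc n"] \<epsilon> by (simp add: distrib_right)
      also have "\<dots> \<le> r" using N1 by (simp add: r_def)
      finally have br: "norm (b (Suc n)) * \<rho> (Suc n) \<le> r" .
      have "d * ?u (Suc n) \<le> norm (w + b (Suc n)) * ?u (Suc n)"
        using dle by (rule mult_right_mono) simp
      also have "\<dots> \<le> \<rho> (Suc (Suc n)) * ?u (Suc (Suc n)) + norm (b (Suc n)) * \<rho> (Suc n) * ?u n"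
        using three_term_bound[of n w] N1(1) w(2) by (simp add: b_def a)
      also have "\<dots> \<le> r * ?u (Suc (Suc n)) + r * ?u n"
        using br N1 \<epsilon> by (intro add_mono mult_right_mono) (auto simp: r_def)
      finally show "d * ?u (Suc n) \<le> r * (?u (Suc (Suc n)) + ?u n)" by (simp add: distrib_left)
    qed simp
    moreover have "infinite (measure_support M \<inter> ball z (\<epsilon> / 4))"
      using lim \<epsilon> by (simp add: islimpt_eq_infinite_ball)
    ultimately show False by (simp add: Int_commute)
  qed
qed

end
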